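(* Let $n\ge 1$. For any closed convex cone $\mathcal{K}\subseteq\mathcal{S}^n$ with $\mathcal{SPN}^n\subseteq\mathcal{K}\subseteq\mathcal{COP}^n$, we have $\ell_{\mathcal{K}}=T_n+1$ and $$\ell_{\rm poly}(\mathcal{K})=\begin{cases}0 & (n=1),\\ T_n-2 & (n\ge 2).\end{cases}$$
   Context: $\mathcal{S}^n$ is the space of real $n\times n$ symmetric matrices and $T_n:=\frac{n(n+1)}{2}$. A set $\mathcal{K}\subseteq\mathcal{S}^n$ is a cone if $\alpha A\in\mathcal{K}$ for all $\alpha\ge 0$ and $A\in\mathcal{K}$. $\mathbb{R}_+^n$ is the set of $n$-dimensional nonnegative real vectors. The copositive cone is $\mathcal{COP}^n:=\{A\in\mathcal{S}^n : x^\top Ax\ge 0\text{ for all }x\in\mathbb{R}_+^n\}$. The SPN cone is $\mathcal{SPN}^n:=\mathcal{S}_+^n+\mathcal{N}^n$ (Minkowski sum), where $\mathcal{S}_+^n$ is the set of positive semidefinite matrices in $\mathcal{S}^n$ and $\mathcal{N}^n$ is the set of matrices in $\mathcal{S}^n$ with only nonnegative elements. A nonempty convex subcone $\mathcal{F}$ of a closed convex cone $\mathcal{K}$ is a face of $\mathcal{K}$ if for any $A,B\in\mathcal{K}$, $A+B\in\mathcal{F}$ implies $A,B\in\mathcal{F}$. A chain of faces of $\mathcal{K}$ of length $l$ is a sequence $\mathcal{F}_l\subsetneq\cdots\subsetneq\mathcal{F}_1$ in which every $\mathcal{F}_i$ is a face of $\mathcal{K}$. $\ell_{\mathcal{K}}$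 denotes the length of the longest chain of faces of $\mathcal{K}$. The distance to polyhedrality $\ell_{\rm poly}(\mathcal{K})$ is the length minus one of the longest chain $\mathcal{F}_l\subsetneq\cdots\subsetneq\mathcal{F}_1$ of faces of $\mathcal{K}$ such that $\mathcal{F}_l$ is polyhedral and every $\mathcal{F}_i$ with $i<l$ is not polyhedral. *)

theory Defs
  imports "HOL-Analysis.Analysis"
begin

definition sym_matrices :: "(real^'n^'n) set"
  where "sym_matrices = {A. transpose A = A}"

definition copositive_cone :: "(real^'n^'n) set"
  where "copositive_cone =
    {A \<in> sym_matrices. \<forall>x. (\<forall>i. 0 \<le> x $ i) \<longrightarrow> 0 \<le> x \<bullet> (A *v x)}"

definition psd_cone :: "(real^'n^'n) set"
  where "psd_cone = {A \<in> sym_matrices. \<forall>x. 0 \<le> x \<bullet> (A *v x)}"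

definition nonneg_cone :: "(real^'n^'n) set"
  where "nonneg_cone = {A \<in> sym_matrices. \<forall>i j. 0 \<le> A $ i $ j}"

definition spn_cone :: "(real^'n^'n) set"
  where "spn_cone = {P + N | P N. P \<in> psd_cone \<and> N \<in> nonneg_cone}"

definition triangular :: "nat \<Rightarrow> nat"
  where "triangular n = n * (n + 1) div 2"

definition cone_face :: "'a::real_vector set \<Rightarrow> 'a set \<Rightarrow> bool"
  where "cone_face K F \<longleftrightarrow> convex_cone F \<and> F \<subseteq> K \<and>
    (\<forall>A\<in>K. \<forall>B\<in>K. A + B \<in> F \<longrightarrow> A \<in> F \<and> B \<in> F)"

(* The list [F1, ..., Fl] stands for the chain Fl \<subset> ... \<subset> F1: the largest face comes first. *)
definition face_chain :: "'a::real_vector set \<Rightarrow> 'a set list \<Rightarrow> bool"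
  where "face_chain K Fs \<longleftrightarrow> Fs \<noteq> [] \<and> (\<forall>F\<in>set Fs. cone_face K F) \<and>
    (\<forall>i. Suc i < length Fs \<longrightarrow> Fs ! Suc i \<subset> Fs ! i)"

(* Suprema are taken in enat, so a finite value of the supremum of a nonempty set
   of lengths is its maximum, i.e. it is the length of an actual chain. *)
definition face_chain_length :: "'a::real_vector set \<Rightarrow> enat"
  where "face_chain_length K = (SUP Fs \<in> {Fs. face_chain K Fs}. enat (length Fs))"

definition poly_face_chain :: "'a::euclidean_space set \<Rightarrow> 'a set list \<Rightarrow> bool"
  where "poly_face_chain K Fs \<longleftrightarrow> face_chain K Fs \<and>
    polyhedron (last Fs) \<and> (\<forall>F\<in>set (butlast Fs). \<not> polyhedron F)"

definition dist_polyhedrality :: "'a::euclidean_space set \<Rightarrow> enat"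
  where "dist_polyhedrality K = (SUP Fs \<in> {Fs. poly_face_chain K Fs}. enat (length Fs)) - 1"

(* Neither supremum ranges over the empty set: the lineality space of a convex cone
   is a polyhedral face. *)
lemma poly_face_chain_exists:
  fixes K :: "'a::euclidean_space set"
  assumes "convex_cone K"
  shows "poly_face_chain K [K \<inter> uminus ` K]"
proof -
  let ?L = "K \<inter> uminus ` K"
  have add: "x + y \<in> K" if "x \<in> K" "y \<in> K" for x y
    using assms that by (rule convex_cone_add)
  have sc: "c *\<^sub>R x \<in> K" if "x \<in> K" "0 \<le> c" for x and c :: real
    using assms that by (auto simp: convex_cone_def conic_def)
  have mem: "x \<in> ?L \<longleftrightarrow> x \<in> K \<and> - x \<in> K" for x
    by (auto simp: image_iff) (metis minus_minus)
  have zero: "0 \<in> K"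
    using assms by (rule convex_cone_contains_0)
  have sub: "subspace ?L"
    unfolding subspace_def mem
  proof (intro conjI ballI allI)
    fix x y assume "x \<in> ?L" "y \<in> ?L"
    then show "x + y \<in> K" "- (x + y) \<in> K"
      using add[of x y] add[of "- x" "- y"] mem by auto
  next
    fix c :: real and x assume "x \<in> ?L"
    then have "x \<in> K" "- x \<in> K" using mem by auto
    then show "c *\<^sub>R x \<in> K" "- (c *\<^sub>R x) \<in> K"
      using sc[of x c] sc[of "- x" "- c"] sc[of "- x" c] sc[of x "- c"]
      by (cases "0 \<le> c"; simp)+
  qed (use zero in auto)
  have face: "A \<in> ?L" if A: "A \<in> K" and B: "B \<in> K" and AB: "A + B \<in> ?L" for A B
  proof -
    have "- (A + B) + B \<in> K" using AB B add mem by blast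
    then show ?thesis using A unfolding mem by simp
  qed
  have "cone_face K ?L"
    unfolding cone_face_def
  proof (intro conjI ballI impI)
    show "convex_cone ?L" using sub by (rule subspace_imp_convex_cone)
  next
    fix A B assume "A \<in> K" "B \<in> K" "A + B \<in> ?L"
    then show "A \<in> ?L" "B \<in> ?L" using face[of A B] face[of B A] by (simp_all add: add.commute)
  qed auto
  moreover have "polyhedron ?L"
    using sub by (intro affine_imp_polyhedron subspace_imp_affine)
  ultimately show ?thesis
    by (simp add: poly_face_chain_def face_chain_def)
qed

end

theory Submission
  imports Defs
begin

text \<open>
  Strictly smaller faces have strictly smaller dimension, and a closed pointed cone of dimension
  at most two is polyhedral; both upper bounds follow from \<open>dim sym_matrices \<le> T_n\<close>. For the lower
  bounds let \<open>Z\<close> be a set of positions \<open>{i,j}\<close> such that \<open>{i,j} \<in> Z\<close> implies \<open>{i} \<in> Z\<close> or \<open>{j} \<in> Z\<close>.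
  The matrices in \<open>K\<close> that vanish on \<open>Z\<close> form a face, because an off-diagonal entry of a copositive
  matrix is nonnegative as soon as one of the two diagonal entries is zero. Enlarging
  \<open>Z\<close> one position at a time, the elementary nonnegative matrices show that the faces decrease
  strictly. While \<open>Z\<close> avoids a fixed \<open>2 \<times> 2\<close> block, the face contains infinitely many extreme
  rays spanned by rank one matrices supported on that block, and so it is not polyhedral.
\<close>

section \<open>Faces of convex cones\<close>

text \<open>If \<open>x\<close> lies between \<open>a\<close> and \<open>b\<close>, the scaled
  endpoints lie in \<open>K\<close> and add up to \<open>x\<close>, so both lie in \<open>F\<close>;
  rescaling recovers \<open>a\<close> and \<open>b\<close>. This gives access to the theory of faces
  of convex sets.\<close>

lemma cone_face_imp_face_of:
  assumes "convex_cone K" "cone_face K F"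
  shows "F face_of K"
  unfolding face_of_def
proof (intro conjI ballI impI)
  have F: "convex_cone F" "F \<subseteq> K" and split: "\<And>A B. \<lbrakk>A \<in> K; B \<in> K; A + B \<in> F\<rbrakk> \<Longrightarrow> A \<in> F \<and> B \<in> F"
    using assms(2) by (auto simp: cone_face_def)
  show "F \<subseteq> K" by fact
  show "convex F" using F by (simp add: convex_cone_def)
  fix a b x assume ab: "a \<in> K" "b \<in> K" and x: "x \<in> F" "x \<in> open_segment a b"
  then obtain u where u: "0 < u" "u < 1" "x = (1 - u) *\<^sub>R a + u *\<^sub>R b"
    by (auto simp: in_segment)
  have "(1 - u) *\<^sub>R a \<in> F \<and> u *\<^sub>R b \<in> F"
    using u ab x assms(1) by (intro split convex_cone_scaleR) auto
  then have "inverse (1 - u) *\<^sub>R ((1 - u) *\<^sub>R a) \<in> F" "inverse u *\<^sub>R (u *\<^sub>R b) \<in> F"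
    using u convex_cone_scaleR[OF F(1), of "inverse (1 - u)"] convex_cone_scaleR[OF F(1), of "inverse u"]
    by (meson diff_ge_0_iff_ge inverse_nonnegative_iff_nonnegative less_imp_le)+
  then show "a \<in> F" "b \<in> F" using u by simp_all
qed

text \<open>A face of \<open>K\<close> inside the face \<open>G\<close> is a face of
  \<open>G\<close>, and proper faces of convex sets lose affine dimension. Cones contain 0, so this
  is linear dimension.\<close>

lemma cone_face_dim_less:
  fixes K :: "'a::euclidean_space set"
  assumes "convex_cone K" "cone_face K F" "cone_face K G" "F \<subset> G"
  shows "dim F < dim G"
proof -
  have cone: "convex_cone F" "convex_cone G"
    using assms by (auto simp: cone_face_def)
  have "cone_face G F"
    using assms cone unfolding cone_face_def by blast
  then have "F face_of G"
    using cone by (intro cone_face_imp_face_of)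
  then have "aff_dim F < aff_dim G"
    using assms cone by (intro face_of_aff_dim_lt) (auto simp: convex_cone_def)
  then show ?thesis
    using cone by (simp add: aff_dim_zero hull_inc convex_cone_contains_0)
qed

lemma face_chain_dim_le:
  fixes K :: "'a::euclidean_space set"
  assumes "convex_cone K" "face_chain K Fs" "i \<le> j" "j < length Fs"
  shows "dim (Fs ! j) + (j - i) \<le> dim (Fs ! i)"
  using assms(3,4)
proof (induction j rule: dec_induct)
  case (step j)
  have "dim (Fs ! Suc j) < dim (Fs ! j)"
    using assms step.prems by (intro cone_face_dim_less[of K]) (auto simp: face_chain_def)
  then show ?case using step by auto
qed simp

text \<open>A compact slice of the cone is a segment, and the cone is generated by its endpoints.\<close>

lemma polyhedron_cone_dim_le_2:
  fixes F :: "'a::euclidean_space set"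
  assumes cone: "convex_cone F" and "closed F"
    and pos: "\<And>x. x \<in> F \<Longrightarrow> x \<noteq> 0 \<Longrightarrow> 0 < c \<bullet> x" and dim: "dim F \<le> 2"
  shows "polyhedron F"
proof (cases "F = {0}")
  case True
  then show ?thesis using polyhedron_convex_cone_hull[of "{} :: 'a set"] by simp
next
  case False
  have scale: "t *\<^sub>R x \<in> F" if "x \<in> F" "0 \<le> t" for x t
    using cone that by (simp add: convex_cone_scaleR)
  obtain x0 where x0: "x0 \<in> F" "x0 \<noteq> 0"
    using False cone convex_cone_contains_0 by blast
  define S where "S = F \<inter> sphere 0 1"
  define B where "B = F \<inter> {x. c \<bullet> x = 1}"
  have "compact S"
    unfolding S_def using \<open>closed F\<close> by (intro closed_Int_compact) auto
  moreover have "S \<noteq> {}"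
    using x0 scale[of x0 "inverse (norm x0)"] by (auto simp: S_def intro!: exI[of _ "x0 /\<^sub>R norm x0"])
  moreover have "continuous_on S (\<lambda>x. c \<bullet> x)"
    by (intro continuous_intros)
  ultimately obtain z where z: "z \<in> S" "\<And>y. y \<in> S \<Longrightarrow> c \<bullet> z \<le> c \<bullet> y"
    using continuous_attains_inf[of S "\<lambda>x. c \<bullet> x"] by blast
  have m: "0 < c \<bullet> z"
    using z by (intro pos) (auto simp: S_def)
  have norm_le: "norm x \<le> inverse (c \<bullet> z)" if "x \<in> B" for x
  proof -
    have x: "x \<in> F" "c \<bullet> x = 1" "x \<noteq> 0" using that by (auto simp: B_def)
    then have "x /\<^sub>R norm x \<in> S"
      using scale[of x "inverse (norm x)"] by (auto simp: S_def)
    then have "c \<bullet> z \<le> c \<bullet> (x /\<^sub>R norm x)" by (rule z)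
    then show ?thesis using x m by (simp add: field_simps)
  qed
  have "bounded B"
    using norm_le by (auto simp: bounded_iff)
  moreover have "closed B"
    unfolding B_def using \<open>closed F\<close> by (intro closed_Int closed_hyperplane)
  ultimately have "compact B" by (simp add: compact_eq_bounded_closed)
  have "convex B"
    using cone by (auto simp: B_def convex_cone_def intro!: convex_Int convex_hyperplane)
  have B: "x /\<^sub>R (c \<bullet> x) \<in> B" if "x \<in> F" "x \<noteq> 0" for x
    using that pos[of x] scale[of x "inverse (c \<bullet> x)"] by (auto simp: B_def)
  \<comment> \<open>The slice misses the origin, so adjoining 0 raises its affine dimension by one;
    as \<open>dim F\<close> is at most 2, \<open>B\<close> lies on a line.\<close>
  have "affine hull B \<subseteq> {x. c \<bullet> x = 1}"
    by (intro hull_minimal) (auto simp: B_def affine_hyperplane)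
  then have "0 \<notin> affine hull B" by auto
  then have "aff_dim B + 1 = aff_dim (insert 0 B)"
    by (simp add: aff_dim_insert)
  also have "\<dots> \<le> aff_dim F"
    using cone convex_cone_contains_0 by (intro aff_dim_subset) (auto simp: B_def)
  also have "\<dots> = dim F"
    using cone by (simp add: aff_dim_zero hull_inc convex_cone_contains_0)
  finally have "collinear B"
    using dim by (simp add: collinear_aff_dim)
  moreover have "B \<noteq> {}" using B x0 by blast
  ultimately obtain a b where ab: "B = closed_segment a b"
    using \<open>compact B\<close> \<open>convex B\<close> compact_convex_collinear_segment by metis
  have "F \<subseteq> convex_cone hull {a, b}"
  proof
    fix x assume "x \<in> F"
    show "x \<in> convex_cone hull {a, b}"
    proof (cases "x = 0")
      case True
      then show ?thesis by (simp add: convex_cone_hull_contains_0)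
    next
      case False
      have "x /\<^sub>R (c \<bullet> x) \<in> convex hull {a, b}"
        using B[OF \<open>x \<in> F\<close> False] ab by (simp add: segment_convex_hull)
      then have "x /\<^sub>R (c \<bullet> x) \<in> convex_cone hull {a, b}"
        using convex_hull_subset_convex_cone_hull by blast
      then have "(c \<bullet> x) *\<^sub>R (x /\<^sub>R (c \<bullet> x)) \<in> convex_cone hull {a, b}"
        using pos[OF \<open>x \<in> F\<close> False] by (intro convex_cone_hull_mul[of _ _ "c \<bullet> x"]) auto
      then show ?thesis using pos[OF \<open>x \<in> F\<close> False] by simp
    qed
  qed
  moreover have "convex_cone hull {a, b} \<subseteq> F"
    using cone ab by (intro hull_minimal) (auto simp: B_def)
  ultimately have "F = convex_cone hull {a, b}" by blast
  then show ?thesis by (simp add: polyhedron_convex_cone_hull)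
qed

section \<open>Positions in symmetric matrices\<close>

text \<open>Unordered pairs identify the entries (i,j) and (j,i); singletons are the diagonal
  positions.\<close>

definition positions :: "'n set set"
  where "positions = {p. \<exists>i j. p = {i, j}}"

definition elem_matrix :: "'n set \<Rightarrow> real^'n^'n"
  where "elem_matrix p = (\<chi> i j. if {i, j} = p then 1 else 0)"

definition admissible :: "'n set set \<Rightarrow> bool"
  where "admissible Z \<longleftrightarrow> (\<forall>i j. {i, j} \<in> Z \<longrightarrow> {i} \<in> Z \<or> {j} \<in> Z)"

definition vanishing :: "'n set set \<Rightarrow> (real^'n^'n) set"
  where "vanishing Z = {A. \<forall>i j. {i, j} \<in> Z \<longrightarrow> A $ i $ j = 0}"

lemma card_positions: "card (positions :: 'n::finite set set) = triangular CARD('n)"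
proof -
  have eq: "positions = {p :: 'n set. p \<subseteq> UNIV \<and> card p = 1} \<union> {p. p \<subseteq> UNIV \<and> card p = 2}"
    by (auto simp: positions_def card_1_singleton_iff card_2_iff card_insert_if)
  have "card (positions :: 'n set set)
      = card {p :: 'n set. p \<subseteq> UNIV \<and> card p = 1} + card {p :: 'n set. p \<subseteq> UNIV \<and> card p = 2}"
    unfolding eq by (rule card_Un_disjoint) auto
  also have "\<dots> = CARD('n) + CARD('n) * (CARD('n) - 1) div 2"
    by (simp only: n_subsets[OF finite] choose_one choose_two)
  also have "\<dots> = triangular CARD('n)"
  proof -
    have "CARD('n) * (CARD('n) + 1) = CARD('n) * 2 + CARD('n) * (CARD('n) - 1)"
      by (cases "CARD('n)") simp_all
    then show ?thesis by (simp add: triangular_def)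
  qed
  finally show ?thesis .
qed

lemma sym_entry: "A \<in> sym_matrices \<Longrightarrow> A $ i $ j = A $ j $ i"
  by (simp add: sym_matrices_def transpose_def vec_eq_iff)

lemma sym_vanishing_subset_span:
  fixes Z :: "'n::finite set set"
  shows "sym_matrices \<inter> vanishing Z \<subseteq> span (elem_matrix ` (positions - Z))"
proof
  fix A :: "real^'n^'n" assume A: "A \<in> sym_matrices \<inter> vanishing Z"
  \<comment> \<open>By symmetry an entry depends only on its unordered position, so
    \<open>v p\<close> is a well-defined coordinate.\<close>
  have "\<forall>p\<in>positions. \<exists>v. \<forall>i j. {i, j} = p \<longrightarrow> A $ i $ j = v"
    using A by (auto simp: positions_def doubleton_eq_iff sym_entry)
  then obtain v where v: "\<And>p i j. p \<in> positions \<Longrightarrow> {i, j} = p \<Longrightarrow> A $ i $ j = v p"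
    by (metis (no_types, lifting))
  have "A = (\<Sum>p\<in>positions - Z. v p *\<^sub>R elem_matrix p)"
  proof (simp only: vec_eq_iff, intro allI)
    fix i j
    have "(\<Sum>p\<in>positions - Z. v p *\<^sub>R elem_matrix p) $ i $ j
        = (\<Sum>p\<in>positions - Z. if {i, j} = p then v p else 0)"
      by (simp add: elem_matrix_def if_distrib cong: if_cong)
    also have "\<dots> = (if {i, j} \<in> positions - Z then v {i, j} else 0)"
      by (simp add: sum.delta')
    also have "\<dots> = A $ i $ j"
      using A v[of "{i, j}" i j] by (auto simp: vanishing_def positions_def)
    finally show "A $ i $ j = (\<Sum>p\<in>positions - Z. v p *\<^sub>R elem_matrix p) $ i $ j" ..
  qed
  also have "\<dots> \<in> span (elem_matrix ` (positions - Z))"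
    by (intro span_sum span_scale span_base) auto
  finally show "A \<in> span (elem_matrix ` (positions - Z))" .
qed

text \<open>Serves both ends of the chains: empty \<open>Z\<close> bounds every face by T_n, large
  \<open>Z\<close> makes the last face small.\<close>

lemma dim_sym_vanishing_le:
  fixes F :: "(real^'n^'n) set"
  assumes "F \<subseteq> sym_matrices \<inter> vanishing Z"
  shows "dim F \<le> card (positions - Z)"
proof -
  have "dim F \<le> card (elem_matrix ` (positions - Z))"
    using assms sym_vanishing_subset_span by (intro dim_le_card) auto
  also have "\<dots> \<le> card (positions - Z)" by (intro card_image_le) simp
  finally show ?thesis .
qed

text \<open>Diagonal positions are listed first. A prefix with an off-diagonal position then
  contains every diagonal position of \<open>W\<close>, and admissibility of \<open>W\<close>
  supplies the one required.\<close>

lemma admissible_enumeration: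
  assumes "admissible W" "finite W" "W \<subseteq> positions"
  obtains ps where "distinct ps" "set ps = W" "\<And>k. admissible (set (take k ps))"
proof -
  define D where "D = {p \<in> W. is_singleton p}"
  obtain ss qs where ss: "set ss = D" "distinct ss" and qs: "set qs = W - D" "distinct qs"
    using assms(2) finite_distinct_list[of D] finite_distinct_list[of "W - D"]
    by (auto simp: D_def)
  have "admissible (set (take k (ss @ qs)))" for k
    unfolding admissible_def
  proof (intro allI impI)
    fix i j assume ij: "{i, j} \<in> set (take k (ss @ qs))"
    show "{i} \<in> set (take k (ss @ qs)) \<or> {j} \<in> set (take k (ss @ qs))"
    proof (cases "i = j")
      case False
      then have "\<not> is_singleton {i, j}" by (auto simp: is_singleton_def)
      then have "{i, j} \<notin> set ss" using ss by (simp add: D_def)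
      then have "{i, j} \<in> set (take (k - length ss) qs)"
        using ij set_take_subset by (fastforce simp: take_append)
      then have "length ss \<le> k" "{i, j} \<in> W"
        using qs set_take_subset[of "k - length ss" qs]
        by (auto intro: leI ccontr)
      then have "{i} \<in> D \<or> {j} \<in> D"
        using assms(1) by (auto simp: D_def admissible_def is_singleton_def)
      then show ?thesis using ss \<open>length ss \<le> k\<close> by auto
    qed (use ij in auto)
  qed
  moreover have "distinct (ss @ qs)" "set (ss @ qs) = W"
    using ss qs by (auto simp: D_def)
  ultimately show ?thesis by (intro that)
qed

section \<open>Quadratic forms\<close>

lemma quadratic_form_axes:
  fixes A :: "real^'n^'n"
  assumes "A \<in> sym_matrices"
  shows "(s *\<^sub>R axis i 1 + t *\<^sub>R axis j 1) \<bullet> (A *v (s *\<^sub>R axis i 1 + t *\<^sub>R axis j 1))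
    = s\<^sup>2 * A $ i $ i + 2 * s * t * A $ i $ j + t\<^sup>2 * A $ j $ j"
proof -
  have e: "axis k 1 \<bullet> (A *v axis l 1) = A $ k $ l" for k l
    by (simp add: matrix_vector_mult_basis column_def inner_axis' )
  have "A $ j $ i = A $ i $ j" using assms by (rule sym_entry)
  then show ?thesis
    by (simp add: e matrix_vector_right_distrib matrix_vector_mult_scaleR inner_add_left
        inner_add_right power2_eq_square algebra_simps)
qed

lemma copositive_axes:
  fixes A :: "real^'n^'n"
  assumes "A \<in> copositive_cone" "0 \<le> s" "0 \<le> t"
  shows "0 \<le> s\<^sup>2 * A $ i $ i + 2 * s * t * A $ i $ j + t\<^sup>2 * A $ j $ j"
proof -
  have A: "A \<in> sym_matrices" "\<And>x. (\<forall>i. 0 \<le> x $ i) \<Longrightarrow> 0 \<le> x \<bullet> (A *v x)"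
    using assms by (auto simp: copositive_cone_def)
  show ?thesis
    unfolding quadratic_form_axes[OF A(1), symmetric] using assms
    by (intro A(2)) (auto simp: axis_def)
qed

lemma copositive_diag:
  assumes "A \<in> copositive_cone" shows "0 \<le> A $ i $ i"
  using copositive_axes[OF assms, of 1 0 i i] by simp

text \<open>With zero diagonal entry at \<open>i\<close>, the form at \<open>s e_i + e_j\<close> is
  affine in \<open>s\<close> with slope \<open>2 * A $ i $ j\<close>; a negative slope would make it
  negative for large \<open>s\<close>.\<close>

lemma copositive_off_diag:
  fixes A :: "real^'n^'n"
  assumes "A \<in> copositive_cone" "A $ i $ i = 0"
  shows "0 \<le> A $ i $ j"
proof (rule ccontr)
  assume neg: "\<not> 0 \<le> A $ i $ j"
  \<comment> \<open>Chosen so that the form takes the value -1.\<close>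
  define s where "s = (A $ j $ j + 1) / (- 2 * A $ i $ j)"
  have "0 \<le> s"
    using neg copositive_diag[OF assms(1), of j] by (simp add: s_def divide_nonneg_neg)
  moreover have "2 * s * A $ i $ j = - (A $ j $ j + 1)"
    using neg by (simp add: s_def field_simps)
  ultimately show False
    using copositive_axes[OF assms(1), of s 1 i j] assms(2) by simp
qed

definition outer :: "real^'n \<Rightarrow> real^'n^'n"
  where "outer w = (\<chi> i j. w $ i * w $ j)"

text \<open>Turns the quadratic form at \<open>w\<close> into a linear functional of the matrix, as
  supporting hyperplanes require.\<close>

lemma inner_outer: "outer w \<bullet> A = w \<bullet> (A *v w)"
  by (simp add: outer_def inner_vec_def matrix_vector_mult_def sum_distrib_left mult_ac)

lemma quadratic_form_outer: "x \<bullet> (outer w *v x) = (w \<bullet> x)\<^sup>2"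
proof -
  have "outer w *v x = (w \<bullet> x) *\<^sub>R w"
    by (simp add: vec_eq_iff outer_def matrix_vector_mult_def inner_vec_def sum_distrib_left mult_ac)
  then show ?thesis by (simp add: power2_eq_square inner_commute)
qed

lemma outer_psd: "outer w \<in> psd_cone"
  unfolding psd_cone_def
  by (simp add: quadratic_form_outer) (simp add: sym_matrices_def transpose_def outer_def mult.commute)

text \<open>The functional \<open>A \<mapsto> \<Sum>\<^sub>i\<^sub>j (e\<^sub>i + e\<^sub>j)\<^sup>T A (e\<^sub>i + e\<^sub>j)\<close> lies in the interior of the dual cone.\<close>

lemma copositive_pointed:
  obtains C :: "real^'n^'n" where "\<And>A. A \<in> copositive_cone \<Longrightarrow> A \<noteq> 0 \<Longrightarrow> 0 < C \<bullet> A"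
proof -
  define C :: "real^'n^'n" where "C = (\<Sum>i\<in>UNIV. \<Sum>j\<in>UNIV. outer (axis i 1 + axis j 1))"
  have "0 < C \<bullet> A" if A: "A \<in> copositive_cone" "A \<noteq> 0" for A
  proof (rule ccontr)
    assume le: "\<not> 0 < C \<bullet> A"
    have sym: "A \<in> sym_matrices" using A by (simp add: copositive_cone_def)
    let ?q = "\<lambda>i j. A $ i $ i + 2 * A $ i $ j + A $ j $ j"
    have C: "C \<bullet> A = (\<Sum>i\<in>UNIV. \<Sum>j\<in>UNIV. ?q i j)"
      using quadratic_form_axes[OF sym, of 1 _ 1] by (simp add: C_def inner_sum_left inner_outer)
    have nn: "0 \<le> ?q i j" for i j
      using copositive_axes[OF A(1), of 1 1 i j] by simp
    \<comment> \<open>A sum of nonnegative terms that is not positive has only zero terms. The terms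
      with \<open>i = j\<close> then kill the diagonal, and the others the remaining
      entries.\<close>
    have q: "?q i j = 0" for i j
    proof -
      have "0 \<le> C \<bullet> A" unfolding C by (intro sum_nonneg nn)
      then have "(\<Sum>i\<in>UNIV. \<Sum>j\<in>UNIV. ?q i j) = 0" using le C by simp
      then have "(\<Sum>j\<in>UNIV. ?q i j) = 0"
        by (subst (asm) sum_nonneg_eq_0_iff) (auto intro!: sum_nonneg nn)
      then show ?thesis
        by (subst (asm) sum_nonneg_eq_0_iff) (auto intro!: nn)
    qed
    have diag: "A $ i $ i = 0" for i using q[of i i] by simp
    have "A = 0" using q by (simp add: vec_eq_iff diag)
    then show False using A by simp
  qed
  then show ?thesis by (rule that)
qed

section \<open>Cones between the SPN cone and the copositive cone\<close>

locale spn_cop_cone =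
  fixes K :: "(real^'n^'n) set"
  assumes cone: "convex_cone K" and closed: "closed K"
    and spn: "spn_cone \<subseteq> K" and cop: "K \<subseteq> copositive_cone"
begin

lemma psd_in: "A \<in> psd_cone \<Longrightarrow> A \<in> K"
proof -
  assume "A \<in> psd_cone"
  moreover have "(0 :: real^'n^'n) \<in> nonneg_cone"
    by (simp add: nonneg_cone_def sym_matrices_def transpose_def vec_eq_iff)
  ultimately have "A + 0 \<in> spn_cone" unfolding spn_cone_def by blast
  then show ?thesis using spn by auto
qed

lemma elem_matrix_in: "elem_matrix p \<in> K"
proof -
  have "elem_matrix p \<in> nonneg_cone"
    by (simp add: nonneg_cone_def sym_matrices_def transpose_def elem_matrix_def insert_commute)
  moreover have "(0 :: real^'n^'n) \<in> psd_cone"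
    by (simp add: psd_cone_def sym_matrices_def transpose_def vec_eq_iff)
  ultimately have "0 + elem_matrix p \<in> spn_cone" unfolding spn_cone_def by blast
  then show ?thesis using spn by auto
qed

lemma subset_sym_matrices: "K \<subseteq> sym_matrices"
  using cop by (auto simp: copositive_cone_def)

text \<open>Nonnegative summands with sum zero vanish. This applies first to the diagonal entries in
  \<open>Z\<close>, then to the rows of those indices, where copositivity makes all entries
  nonnegative; admissibility and symmetry reach every position of \<open>Z\<close> this way.\<close>

lemma cone_face_vanishing:
  assumes "admissible Z"
  shows "cone_face K (K \<inter> vanishing Z)"
  unfolding cone_face_def
proof (intro conjI ballI impI)
  show "convex_cone (K \<inter> vanishing Z)"
    using cone by (auto simp: convex_cone_iff vanishing_def)
  fix A B assume AB: "A \<in> K" "B \<in> K" "A + B \<in> K \<inter> vanishing Z"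
  have copAB: "A \<in> copositive_cone" "B \<in> copositive_cone" using AB cop by auto
  have sum0: "A $ i $ j + B $ i $ j = 0" if "{i, j} \<in> Z" for i j
    using AB that by (auto simp: vanishing_def)
  have diag: "A $ i $ i = 0 \<and> B $ i $ i = 0" if "{i} \<in> Z" for i
    using sum0[of i i] that copAB[THEN copositive_diag, of i] by auto
  have row: "A $ i $ j = 0 \<and> B $ i $ j = 0" if "{i, j} \<in> Z" "{i} \<in> Z" for i j
    using sum0[OF that(1)] diag[OF that(2)] copositive_off_diag[OF copAB(1), of i j]
      copositive_off_diag[OF copAB(2), of i j] by auto
  have "A $ i $ j = 0 \<and> B $ i $ j = 0" if ij: "{i, j} \<in> Z" for i j
  proof (cases "{i} \<in> Z")
    case False
    then have "{j} \<in> Z" using assms ij by (auto simp: admissible_def)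
    then show ?thesis
      using row[of j i] ij sym_entry[of A i j] sym_entry[of B i j] AB subset_sym_matrices
      by (auto simp: insert_commute)
  qed (use row ij in blast)
  then show "A \<in> K \<inter> vanishing Z" "B \<in> K \<inter> vanishing Z"
    using AB by (auto simp: vanishing_def)
qed auto

lemma vanishing_psubset:
  assumes "Z \<subset> Z'" "Z' \<subseteq> positions"
  shows "K \<inter> vanishing Z' \<subset> K \<inter> vanishing Z"
proof -
  obtain p where p: "p \<in> Z'" "p \<notin> Z" using assms by blast
  \<comment> \<open>Only a genuine position constrains an entry, so that
    \<open>elem_matrix p\<close> separates the two faces.\<close>
  then have "p \<in> positions" using assms by blast
  then obtain i j where ij: "p = {i, j}" by (auto simp: positions_def)
  have "elem_matrix p \<in> vanishing Z"
    using p by (auto simp: vanishing_def elem_matrix_def)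
  moreover have "elem_matrix p \<notin> vanishing Z'"
  proof
    assume "elem_matrix p \<in> vanishing Z'"
    then have "elem_matrix p $ i $ j = 0" using p(1) unfolding ij vanishing_def by blast
    then show False by (simp add: elem_matrix_def ij)
  qed
  moreover have "vanishing Z' \<subseteq> vanishing Z"
    using assms by (auto simp: vanishing_def)
  ultimately show ?thesis using elem_matrix_in by blast
qed

text \<open>For \<open>t > 0\<close> the matrices of the face whose quadratic form vanishes at \<open>t e\<^sub>a + e\<^sub>b\<close> form pairwise
  different faces, told apart by the rank one matrices of \<open>e\<^sub>a - t e\<^sub>b\<close>.\<close>

lemma not_polyhedron_vanishing:
  assumes "a \<noteq> b" "Z \<inter> Pow {a, b} = {}"
  shows "\<not> polyhedron (K \<inter> vanishing Z)"
proof
  let ?F = "K \<inter> vanishing Z"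
  define v where "v t = t *\<^sub>R axis a 1 + axis b (1::real)" for t :: real
  define w where "w t = axis a 1 - t *\<^sub>R axis b (1::real)" for t :: real
  define G where "G t = ?F \<inter> {A. outer (v t) \<bullet> A = 0}" for t
  assume "polyhedron ?F"
  then have fin: "finite {G. G face_of ?F}" by (rule finite_polyhedron_faces)
  have conv: "convex ?F"
    using cone by (auto simp: convex_cone_iff vanishing_def convex_def)
  have face: "G t face_of ?F" if "0 < t" for t
    unfolding G_def
  proof (rule face_of_Int_supporting_hyperplane_ge[OF conv])
    fix A assume "A \<in> ?F"
    then have "A \<in> copositive_cone" using cop by auto
    moreover have "\<forall>i. 0 \<le> v t $ i" using that by (auto simp: v_def axis_def)
    ultimately show "0 \<le> outer (v t) \<bullet> A"
      by (auto simp: inner_outer copositive_cone_def)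
  qed
  have outer_w: "outer (w t) \<in> ?F" for t
  proof -
    \<comment> \<open>The nonzero entries lie in the block of \<open>a\<close> and \<open>b\<close>,
      which \<open>Z\<close> avoids.\<close>
    have "outer (w t) $ i $ j = 0" if "{i, j} \<in> Z" for i j
    proof -
      have "\<not> {i, j} \<subseteq> {a, b}" using that assms by auto
      then show ?thesis by (auto simp: outer_def w_def axis_def)
    qed
    then show ?thesis by (auto simp: vanishing_def intro: psd_in outer_psd)
  qed
  \<comment> \<open>The form of \<open>outer (w t)\<close> at \<open>v s\<close> is thus the square
    of \<open>s - t\<close>, which is zero only for \<open>s = t\<close>.\<close>
  have wv: "w t \<bullet> v s = s - t" for s t
    using assms(1) by (simp add: w_def v_def inner_diff_left inner_add_right inner_axis_axis)
  have G_iff: "outer (w t) \<in> G s \<longleftrightarrow> s = t" for s t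
    using outer_w by (simp add: G_def inner_outer quadratic_form_outer wv)
  have "inj_on G {0<..}"
    by (intro inj_onI) (metis G_iff)
  moreover have "infinite {0::real<..}" by (rule infinite_Ioi)
  ultimately have "infinite (G ` {0<..})" by (simp add: finite_image_iff)
  moreover have "G ` {0<..} \<subseteq> {G. G face_of ?F}" using face by auto
  ultimately show False using fin finite_subset by blast
qed

text \<open>Faces of a closed convex set are closed, and the functional from
  \<open>copositive_pointed\<close> is positive on \<open>F\<close> away from 0.\<close>

lemma polyhedron_face:
  assumes "cone_face K F" "dim F \<le> 2"
  shows "polyhedron F"
proof -
  obtain C :: "real^'n^'n" where C: "\<And>A. A \<in> copositive_cone \<Longrightarrow> A \<noteq> 0 \<Longrightarrow> 0 < C \<bullet> A"
    by (rule copositive_pointed) blast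
  show ?thesis
  proof (rule polyhedron_cone_dim_le_2)
    show "convex_cone F" using assms by (simp add: cone_face_def)
    show "closed F"
      using cone closed cone_face_imp_face_of[OF cone assms(1)]
      by (auto simp: convex_cone_def intro: face_of_imp_closed)
    show "0 < C \<bullet> A" if "A \<in> F" "A \<noteq> 0" for A
      using that assms cop by (intro C) (auto simp: cone_face_def)
  qed fact
qed

section \<open>Upper bounds on chain lengths\<close>

lemma dim_face_le:
  assumes "cone_face K F"
  shows "dim F \<le> triangular CARD('n)"
proof -
  have "F \<subseteq> sym_matrices \<inter> vanishing {}"
    using assms subset_sym_matrices by (auto simp: cone_face_def vanishing_def)
  from dim_sym_vanishing_le[OF this] show ?thesis by (simp add: card_positions)
qed

lemma face_chain_length_le:
  assumes "face_chain K Fs"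
  shows "length Fs \<le> triangular CARD('n) + 1"
proof -
  have "Fs \<noteq> []" using assms by (simp add: face_chain_def)
  then have "dim (Fs ! (length Fs - 1)) + (length Fs - 1 - 0) \<le> dim (Fs ! 0)"
    using assms by (intro face_chain_dim_le[OF cone]) auto
  moreover have "dim (Fs ! 0) \<le> triangular CARD('n)"
    using assms \<open>Fs \<noteq> []\<close> by (intro dim_face_le) (auto simp: face_chain_def)
  ultimately show ?thesis by linarith
qed

text \<open>The last but one face is not polyhedral, so its dimension is at least 3. It is reached
  after \<open>length Fs - 2\<close> strict drops from at most T_n. A chain of length one has no
  such face.\<close>

lemma poly_face_chain_length_le:
  assumes "poly_face_chain K Fs" "length Fs \<noteq> 1"
  shows "length Fs + 1 \<le> triangular CARD('n)"
proof -
  have chain: "face_chain K Fs" and np: "\<forall>F\<in>set (butlast Fs). \<not> polyhedron F"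
    using assms by (auto simp: poly_face_chain_def)
  have face: "cone_face K (Fs ! i)" if "i < length Fs" for i
    using chain that by (auto simp: face_chain_def)
  have len: "2 \<le> length Fs"
    using assms chain by (cases Fs) (auto simp: face_chain_def Suc_le_eq)
  let ?j = "length Fs - 2"
  have "Fs ! ?j = butlast Fs ! ?j" using len by (simp add: nth_butlast)
  also have "\<dots> \<in> set (butlast Fs)" using len by (intro nth_mem) auto
  finally have "\<not> polyhedron (Fs ! ?j)" using np by blast
  then have "3 \<le> dim (Fs ! ?j)"
    using polyhedron_face[of "Fs ! ?j"] face[of ?j] len by force
  moreover have "dim (Fs ! ?j) + (?j - 0) \<le> dim (Fs ! 0)"
    using len by (intro face_chain_dim_le[OF cone chain]) auto
  moreover have "dim (Fs ! 0) \<le> triangular CARD('n)"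
    using len by (intro dim_face_le face) auto
  ultimately show ?thesis using len by linarith
qed

section \<open>Chains attaining the bounds\<close>

text \<open>Prefixes of lengths 0 to \<open>length ps\<close> give one face more than there are
  positions, starting with \<open>K\<close> itself for the empty prefix.\<close>

lemma face_chain_take:
  assumes "distinct ps" "set ps \<subseteq> positions" "\<And>k. admissible (set (take k ps))"
  shows "face_chain K (map (\<lambda>k. K \<inter> vanishing (set (take k ps))) [0..<length ps + 1])"
  unfolding face_chain_def
proof (intro conjI ballI allI impI)
  let ?Fs = "map (\<lambda>k. K \<inter> vanishing (set (take k ps))) [0..<length ps + 1]"
  show "?Fs \<noteq> []" by simp
  show "cone_face K F" if "F \<in> set ?Fs" for F
  proof -
    obtain k where "F = K \<inter> vanishing (set (take k ps))"
      using \<open>F \<in> set ?Fs\<close> by (auto simp del: upt_Suc)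
    then show ?thesis using cone_face_vanishing[OF assms(3)] by simp
  qed
  fix i assume "Suc i < length ?Fs"
  then have i: "i < length ps" by simp
  have "set (take (Suc i) ps) = insert (ps ! i) (set (take i ps))"
    using i by (simp add: take_Suc_conv_app_nth)
  moreover have "ps ! i \<notin> set (take i ps)"
    using i assms(1) by (auto simp: in_set_conv_nth nth_eq_iff_index_eq)
  ultimately have "set (take i ps) \<subset> set (take (Suc i) ps)" by blast
  moreover have "set (take (Suc i) ps) \<subseteq> positions"
    using set_take_subset assms(2) by (rule order_trans)
  ultimately have less: "K \<inter> vanishing (set (take (Suc i) ps)) \<subset> K \<inter> vanishing (set (take i ps))"
    by (rule vanishing_psubset)
  have nth: "?Fs ! k = K \<inter> vanishing (set (take k ps))" if "k \<le> length ps" for k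
    using that by (simp del: upt_Suc)
  show "?Fs ! Suc i \<subset> ?Fs ! i"
    using less i by (subst (1 2) nth) simp_all
qed

lemma long_face_chain:
  obtains Fs where "face_chain K Fs" "length Fs = triangular CARD('n) + 1"
proof -
  have "admissible (positions :: 'n set set)"
    by (auto simp: admissible_def positions_def)
  then obtain ps where ps: "distinct ps" "set ps = (positions :: 'n set set)"
      "\<And>k. admissible (set (take k ps))"
    by (rule admissible_enumeration) auto
  have "length ps = triangular CARD('n)"
    using distinct_card[OF ps(1)] ps(2) by (simp add: card_positions)
  then show ?thesis
    using ps(2) by (intro that[OF face_chain_take[OF ps(1) _ ps(3)]]) simp_all
qed

text \<open>All T_n - 3 positions outside one 2 by 2 block are used first, so the faces stay
  non-polyhedral. One diagonal position of the block then leaves dimension at most 2. These T_n - 2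
  positions give T_n - 1 faces.\<close>

lemma long_poly_face_chain:
  assumes "CARD('n) \<noteq> 1"
  obtains Fs where "poly_face_chain K Fs" "length Fs + 1 = triangular CARD('n)"
proof -
  obtain a b :: 'n where ab: "a \<noteq> b"
  proof -
    have "\<not> (\<forall>a b :: 'n. a = b)"
    proof
      assume "\<forall>a b :: 'n. a = b"
      then have "UNIV = {undefined :: 'n}" by blast
      then show False using assms by (metis card_1_singleton_iff One_nat_def)
    qed
    then show ?thesis using that by blast
  qed
  define W where "W = positions - {{a}, {a, b}, {b}}"
  \<comment> \<open>An off-diagonal position other than \<open>{a, b}\<close> has an index outside
    the block, whose diagonal position lies in \<open>W\<close>.\<close>
  have W_adm: "admissible W"
    using ab by (auto simp: admissible_def W_def positions_def doubleton_eq_iff)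
  then obtain qs where qs: "distinct qs" "set qs = W" "\<And>k. admissible (set (take k qs))"
    by (rule admissible_enumeration) (auto simp: W_def)
  define ps where "ps = qs @ [{a}]"
  have sub: "{{a}, {a, b}, {b}} \<subseteq> (positions :: 'n set set)"
    by (auto simp: positions_def)
  have W3: "card {{a}, {a, b}, {b}} = 3"
    using ab by (auto simp: card_insert_if doubleton_eq_iff)
  have card_W: "card W + 3 = triangular CARD('n)"
    using card_Diff_subset[OF _ sub] card_mono[OF _ sub] W3 by (simp add: W_def card_positions)
  have len: "length qs = card W" using distinct_card[OF qs(1)] qs(2) by simp
  have dist: "distinct ps" using qs by (auto simp: ps_def W_def)
  have ps_pos: "set ps \<subseteq> positions" using qs sub by (auto simp: ps_def W_def)
  have adm: "admissible (set (take k ps))" for k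
  proof (cases "k \<le> length qs")
    case False
    then have "set (take k ps) = insert {a} W" using qs by (auto simp: ps_def)
    then show ?thesis using W_adm by (auto simp: admissible_def)
  qed (use qs in \<open>simp add: ps_def\<close>)
  let ?F = "\<lambda>k. K \<inter> vanishing (set (take k ps))"
  let ?Fs = "map ?F [0..<length ps + 1]"
  have chain: "face_chain K ?Fs" by (rule face_chain_take[OF dist ps_pos adm])
  have "polyhedron (?F (length ps))"
  proof (rule polyhedron_face)
    show "cone_face K (?F (length ps))" by (rule cone_face_vanishing[OF adm])
    have "dim (?F (length ps)) \<le> card (positions - set ps)"
      using subset_sym_matrices by (intro dim_sym_vanishing_le) auto
    also have "\<dots> \<le> card {{a, b}, {b}}"
      using qs by (intro card_mono) (auto simp: ps_def W_def)
    also have "\<dots> \<le> 2" by (simp add: card_insert_if)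
    finally show "dim (?F (length ps)) \<le> 2" .
  qed
  moreover have "\<not> polyhedron (?F k)" if "k < length ps" for k
  proof (rule not_polyhedron_vanishing[OF ab])
    \<comment> \<open>A proper prefix of \<open>ps\<close> stops before the final
      \<open>{a}\<close>.\<close>
    have "set (take k ps) \<subseteq> W"
      using that qs set_take_subset[of k qs] by (auto simp: ps_def)
    moreover have "p \<notin> Pow {a, b}" if "p \<in> W" for p
      using that by (auto simp: W_def positions_def)
    ultimately show "set (take k ps) \<inter> Pow {a, b} = {}" by blast
  qed
  ultimately have "poly_face_chain K ?Fs"
    using chain by (auto simp: poly_face_chain_def butlast_append)
  moreover have "length ?Fs + 1 = triangular CARD('n)"
    using len card_W by (simp add: ps_def)
  ultimately show ?thesis by (rule that)
qed

section \<open>The two chain invariants\<close>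

lemma face_chain_length_eq: "face_chain_length K = enat (triangular CARD('n) + 1)"
  unfolding face_chain_length_def
proof (rule antisym)
  show "(SUP Fs \<in> {Fs. face_chain K Fs}. enat (length Fs)) \<le> enat (triangular CARD('n) + 1)"
    using face_chain_length_le by (intro SUP_least) auto
  obtain Fs where "face_chain K Fs" "length Fs = triangular CARD('n) + 1"
    by (rule long_face_chain)
  then show "enat (triangular CARD('n) + 1) \<le> (SUP Fs \<in> {Fs. face_chain K Fs}. enat (length Fs))"
    by (intro SUP_upper2[of Fs]) auto
qed

lemma dist_polyhedrality_eq:
  "dist_polyhedrality K = (if CARD('n) = 1 then 0 else enat (triangular CARD('n) - 2))"
proof (cases "CARD('n) = 1")
  case True
  have "(SUP Fs \<in> {Fs. poly_face_chain K Fs}. enat (length Fs)) \<le> 1"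
  proof (intro SUP_least)
    fix Fs assume "Fs \<in> {Fs. poly_face_chain K Fs}"
    \<comment> \<open>Here T_1 = 1, so the bound for longer chains cannot hold.\<close>
    then have "length Fs = 1"
      using poly_face_chain_length_le[of Fs] True
      by (auto simp: triangular_def poly_face_chain_def face_chain_def)
    then show "enat (length Fs) \<le> 1" by (simp add: one_enat_def)
  qed
  then have "dist_polyhedrality K \<le> 1 - 1"
    unfolding dist_polyhedrality_def
    by (cases "SUP Fs \<in> {Fs. poly_face_chain K Fs}. enat (length Fs)")
      (auto simp: one_enat_def zero_enat_def)
  then show ?thesis using True by simp
next
  case False
  obtain Fs where Fs: "poly_face_chain K Fs" "length Fs + 1 = triangular CARD('n)"
    by (rule long_poly_face_chain[OF False])
  have "Fs \<noteq> []" using Fs by (auto simp: poly_face_chain_def face_chain_def)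
  have "(SUP Fs \<in> {Fs. poly_face_chain K Fs}. enat (length Fs)) = enat (length Fs)"
  proof (rule antisym)
    show "(SUP Fs \<in> {Fs. poly_face_chain K Fs}. enat (length Fs)) \<le> enat (length Fs)"
    proof (intro SUP_least)
      fix Gs assume "Gs \<in> {Fs. poly_face_chain K Fs}"
      \<comment> \<open>One-element chains escape the general bound but are no longer than the
        nonempty \<open>Fs\<close>.\<close>
      then have "length Gs = 1 \<or> length Gs + 1 \<le> length Fs + 1"
        using poly_face_chain_length_le[of Gs] Fs by auto
      then show "enat (length Gs) \<le> enat (length Fs)"
        using \<open>Fs \<noteq> []\<close> by (auto simp: Suc_le_eq)
    qed
    show "enat (length Fs) \<le> (SUP Fs \<in> {Fs. poly_face_chain K Fs}. enat (length Fs))"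
      using Fs by (intro SUP_upper) auto
  qed
  then have "dist_polyhedrality K = enat (length Fs - 1)"
    by (simp add: dist_polyhedrality_def one_enat_def)
  moreover have "length Fs - 1 = triangular CARD('n) - 2" using Fs by simp
  ultimately show ?thesis using False by simp
qed

end

theorem corollary4p4:
  fixes K :: "(real^'n^'n) set"
  assumes "convex_cone K" and "closed K"
    and "K \<subseteq> sym_matrices"
    and "spn_cone \<subseteq> K" and "K \<subseteq> copositive_cone"
  shows "face_chain_length K = enat (triangular CARD('n) + 1) \<and>
    dist_polyhedrality K =
      (if CARD('n) = 1 then 0 else enat (triangular CARD('n) - 2))"
proof -
  interpret spn_cop_cone K using assms by unfold_locales
  show ?thesis using face_chain_length_eq dist_polyhedrality_eq by simp
qed

end
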